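(* Let $m\in\mathbb{N}$, let $s$ be an integer with $1\le s\le m-1$ and $s\mid m$, and write $m=k_0s$ with $k_0\in\mathbb{N}$. Let $u=[u_1,\dots,u_m]^T\in\mathbb{C}^m$ with all $u_i\ne 0$, and let $C(u,\pi_s)=\sum_{r=0}^{k}c_rP(u,\pi_s)^r$ (with $k\in\mathbb{N}$ and $c_0,\dots,c_k\in\mathbb{C}$) be a generalized circulant matrix of order $m$ corresponding to $P(u,\pi_s)$. Then the set of vectors $$\{\mathbb{T}^{\lambda_{t,\ell}}\,:\, t=1,2,\dots,s \text{ and } \ell=0,1,\dots,k_0-1\}$$ (one vector for each pair $(t,\ell)$, as defined in the context) forms a basis (of $\mathbb{C}^m$) of eigenvectors of $C(u,\pi_s)$.
   Context: For $s\in\{0,1,\dots,m-1\}$, $\pi_s$ is the permutation $\pi_s(x)=(x+s)\ (\mathrm{mod}\ m)$ of the indices modulo $m$; row and column indices of $m\times m$ matrices are taken in $\{1,\dots,m\}$, with residue $0$ identified with $m$. The permutation matrix $P_{\pi}=(p_{i,j})$ has $p_{i,j}=1$ if $j=\pi(i)$ and $0$ otherwise. For $u\in\mathbb{C}^m$, $P(u,\pi_s)=D_uP_{\pi_s}$ with $D_u=\mathrm{diag}(u_1,\dots,u_m)$; thus the only nonzero entry of row $i$ of $P(u,\pi_s)$ is $u_i$, in column $\pi_s(i)$. A generalized circulant matrix corresponding to $P(u,\pi_s)$ is a matrix $C(u,\pi_s)=\sum_{r=0}^{k}c_rP(u,\pi_s)^r$ with $k\in\mathbb{N}$ and $c_r\in\mathbb{C}$.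 Here $\omega=\exp\left(\frac{2\pi\mathrm{i}}{k_0}\right)$, with $\mathrm{i}$ the imaginary unit. For $j\in\mathbb{N}$ and an index $i$, $\mathrm{prod}_j(i)=\prod_{\ell=0}^{j-1}u_{\pi_s^{\ell}(i)}$, and $\mathrm{prod}_0(i)=1$. For $t=1,\dots,s$ and $\ell=0,\dots,k_0-1$, let $\lambda_{t,0}=\left(\mathrm{prod}_{k_0}(t)\right)^{1/k_0}$ (a fixed complex $k_0$-th root of $\mathrm{prod}_{k_0}(t)=\prod_{q=0}^{k_0-1}u_{t+qs}$) and $\lambda_{t,\ell}=\lambda_{t,0}\,\omega^{\ell}$. Let $\mathbf{e}_t\in\mathbb{C}^s$ be the $t$-th column of the identity matrix of order $s$, and for $k=1,\dots,k_0$ let $$\mathbb{T}_k^{\lambda_{t,0}}=\frac{\lambda_{t,0}^{k-1}}{\mathrm{prod}_{k-1}(t)}\,\mathbf{e}_t\in\mathbb{C}^s.$$ Finally, $\mathbb{T}^{\lambda_{t,\ell}}=\mathbb{T}^{\lambda_{t,0}}(\omega^{\ell})\in\mathbb{C}^{m}$ is the block vector with $k_0$ blocks of size $s$ whose $k$-th block is $\omega^{k\ell}\,\mathbb{T}_k^{\lambda_{t,0}}$, $k=1,\dots,k_0$. *)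

theory Defs
  imports
    Complex_Main
    "Jordan_Normal_Form.Char_Poly"
    "Jordan_Normal_Form.VS_Connect"
begin

text \<open>
  Row and column indices of the mathematical objects range over \<open>{1..m}\<close>, whereas library vectors
  and matrices are indexed from \<open>0\<close>. The permutation \<open>shift_perm\<close> and the parameters \<open>i\<close>, \<open>t\<close>
  and \<open>k\<close> (block number) below are 1-based; the conversion happens only where an entry is accessed.
\<close>

definition entry :: "complex vec \<Rightarrow> nat \<Rightarrow> complex" where
  "entry u i = u $ (i - 1)"

text \<open>Addition of \<open>s\<close> modulo \<open>m\<close> on \<open>{1..m}\<close>, the residue \<open>0\<close> being represented by \<open>m\<close>.\<close>

definition shift_perm :: "nat \<Rightarrow> nat \<Rightarrow> nat \<Rightarrow> nat" where
  "shift_perm m s x = (if (x + s) mod m = 0 then m else (x + s) mod m)"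

definition perm_matrix :: "nat \<Rightarrow> (nat \<Rightarrow> nat) \<Rightarrow> complex mat" where
  "perm_matrix m p = mat m m (\<lambda>(i, j). if Suc j = p (Suc i) then 1 else 0)"

definition diag_matrix :: "nat \<Rightarrow> complex vec \<Rightarrow> complex mat" where
  "diag_matrix m u = mat m m (\<lambda>(i, j). if i = j then entry u (Suc i) else 0)"

definition weighted_perm_matrix :: "nat \<Rightarrow> complex vec \<Rightarrow> nat \<Rightarrow> complex mat" where
  "weighted_perm_matrix m u s = diag_matrix m u * perm_matrix m (shift_perm m s)"

definition gen_circulant ::
    "nat \<Rightarrow> complex vec \<Rightarrow> nat \<Rightarrow> nat \<Rightarrow> (nat \<Rightarrow> complex) \<Rightarrow> complex mat" where
  "gen_circulant m u s k c =
     finsum (module_mat TYPE(complex) m m)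
       (\<lambda>r. c r \<cdot>\<^sub>m (weighted_perm_matrix m u s ^\<^sub>m r)) {0..k}"

definition orbit_prod :: "nat \<Rightarrow> complex vec \<Rightarrow> nat \<Rightarrow> nat \<Rightarrow> nat \<Rightarrow> complex" where
  "orbit_prod m u s j i = (\<Prod>l<j. entry u ((shift_perm m s ^^ l) i))"

definition root_unity :: "nat \<Rightarrow> complex" where
  "root_unity k\<^sub>0 = exp (2 * complex_of_real pi * \<i> / of_nat k\<^sub>0)"

text \<open>The \<open>k\<close>-th block, of size \<open>s\<close>, of the vector attached to the orbit of \<open>t\<close> and the root \<open>lam\<close>.\<close>

definition T_block ::
    "nat \<Rightarrow> complex vec \<Rightarrow> nat \<Rightarrow> nat \<Rightarrow> complex \<Rightarrow> nat \<Rightarrow> complex vec" where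
  "T_block m u s t lam k =
     (lam ^ (k - 1) / orbit_prod m u s (k - 1) t) \<cdot>\<^sub>v unit_vec s (t - 1)"

text \<open>
  Concatenation of the blocks \<open>\<omega> ^ (k * l) \<cdot> T_block k\<close> for \<open>k = 1, \<dots>, k\<^sub>0\<close>:
  the 0-based position \<open>i\<close> is position \<open>i mod s\<close> of block number \<open>i div s + 1\<close>.
\<close>

definition T_vec ::
    "nat \<Rightarrow> complex vec \<Rightarrow> nat \<Rightarrow> nat \<Rightarrow> nat \<Rightarrow> complex \<Rightarrow> nat \<Rightarrow> complex vec" where
  "T_vec m u s k\<^sub>0 t lam l =
     vec (k\<^sub>0 * s) (\<lambda>i. let k = i div s + 1 in
       (root_unity k\<^sub>0 ^ (k * l) \<cdot>\<^sub>v T_block m u s t lam k) $ (i mod s))"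

end

theory Submission
  imports Defs
begin

text \<open>
  Write \<open>m = k\<^sub>0 * s\<close>. The matrix \<open>P = P(u, \<pi>\<^sub>s)\<close> sends the coordinate at position \<open>t + (q + 1) s\<close> to
  position \<open>t + q s\<close>, weighted by \<open>u\<close>, so \<open>\<complex>\<^sup>m\<close> splits into \<open>s\<close> invariant coordinate subspaces of
  dimension \<open>k\<^sub>0\<close>, one for each residue class of the index modulo \<open>s\<close>. On the class of \<open>t\<close>, the equation
  \<open>P v = \<mu> v\<close> is a first-order recursion whose solution is \<open>\<mu>\<^sup>q\<close> divided by the product of the first \<open>q\<close>
  weights met; it closes up around the cycle exactly when \<open>\<mu> ^ k\<^sub>0\<close> is the product of all the weights
  of the class. Its solutions are the \<open>k\<^sub>0\<close> numbers \<open>\<mu> = \<lambda>\<^sub>t \<omega>\<^sup>l\<close>, and the resulting vectors are the given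
  ones up to the scalar \<open>\<omega>\<^sup>l\<close> (\<open>weighted_perm_eigenvector\<close>). A polynomial in \<open>P\<close> keeps the
  eigenvectors of \<open>P\<close> (\<open>eigenvector_gen_circulant\<close>).

  Eigenvalues may coincide for different \<open>t\<close>, so independence does not come from distinct
  eigenvalues. Instead the family has an explicit dual family: vectors with different \<open>t\<close> have disjoint
  supports, and for equal \<open>t\<close> they are, after rescaling the coordinates, the columns of a discrete
  Fourier matrix, which is inverted by the orthogonality of the powers of \<open>\<omega>\<close>
  (\<open>T_vec_biorthogonal\<close>). A family of \<open>m\<close> vectors in \<open>\<complex>\<^sup>m\<close> with a dual family is a basis
  (\<open>basis_of_biorthogonal\<close>).
\<close>

section \<open>Families with a dual family\<close>

text \<open>
  Pairing a vanishing linear combination with the dual vector of index \<open>i\<close> isolates the coefficient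
  of \<open>f i\<close>; the same pairing tells \<open>f i\<close> from \<open>f j\<close>, so the image has \<open>n\<close> elements.
\<close>

lemma basis_of_biorthogonal:
  fixes f g :: "'i \<Rightarrow> 'a :: field vec"
  assumes index_finite: "finite I" and card: "card I = n"
    and f: "\<And>i. i \<in> I \<Longrightarrow> f i \<in> carrier_vec n"
    and g: "\<And>i. i \<in> I \<Longrightarrow> g i \<in> carrier_vec n"
    and diag: "\<And>i. i \<in> I \<Longrightarrow> f i \<bullet> g i \<noteq> 0"
    and off_diag: "\<And>i j. i \<in> I \<Longrightarrow> j \<in> I \<Longrightarrow> i \<noteq> j \<Longrightarrow> f j \<bullet> g i = 0"
  shows "inj_on f I" and "vectorspace.basis class_ring (module_vec TYPE('a) n) (f ` I)"
proof -
  interpret vec_space "TYPE('a)" n .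
  show inj: "inj_on f I"
    by (rule inj_onI) (metis diag off_diag)
  have carrier: "f ` I \<subseteq> carrier_vec n"
    using f by auto
  have indep: "lin_indpt (f ` I)"
  proof (rule finite_lin_indpt2)
    show "finite (f ` I)" using index_finite by simp
    show "f ` I \<subseteq> carrier_vec n" by (rule carrier)
    fix a assume zero: "lincomb a (f ` I) = 0\<^sub>v n"
    show "\<forall>v\<in>f ` I. a v = 0"
    proof
      fix v assume "v \<in> f ` I"
      then obtain i where i: "i \<in> I" and v: "v = f i" by auto
      have "0 = lincomb a (f ` I) \<bullet> g i"
        using zero g[OF i] by simp
      also have "\<dots> = (\<Sum>w\<in>f ` I. (a w \<cdot>\<^sub>v w) \<bullet> g i)"
        unfolding lincomb_def
        by (rule finsum_scalar_prod_sum) (use carrier g[OF i] in auto)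
      also have "\<dots> = (\<Sum>j\<in>I. a (f j) * (f j \<bullet> g i))"
        unfolding sum.reindex[OF inj] o_def
        by (rule sum.cong) (use f g[OF i] in \<open>auto intro: smult_scalar_prod_distrib\<close>)
      also have "\<dots> = (\<Sum>j\<in>I. if j = i then a (f i) * (f i \<bullet> g i) else 0)"
        by (rule sum.cong) (use off_diag i in auto)
      also have "\<dots> = a v * (f i \<bullet> g i)"
        using index_finite i v by simp
      finally show "a v = 0"
        using diag[OF i] by simp
    qed
  qed
  show "basis (f ` I)"
    by (rule dim_li_is_basis)
      (use index_finite carrier indep card in \<open>auto simp: dim_is_n card_image[OF inj]\<close>)
qed

section \<open>Orthogonality of the powers of a root of unity\<close>

lemma root_unity_power_eq_cis: "root_unity n ^ l = cis (2 * pi * real l / real n)"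
  unfolding root_unity_def by (simp add: cis_conv_exp exp_of_nat_mult [symmetric] mult_ac)

lemma root_unity_neq_0 [simp]: "root_unity n \<noteq> 0"
  unfolding root_unity_def by simp

lemma root_unity_power_order: "n > 0 \<Longrightarrow> root_unity n ^ n = 1"
  by (simp add: root_unity_power_eq_cis)

lemma sum_root_unity_quotient:
  assumes "l < n" and "l' < n"
  shows "(\<Sum>q<n. (root_unity n ^ l' / root_unity n ^ l) ^ q) = (if l = l' then of_nat n else 0)"
proof (cases "l = l'")
  case False
  define z where "z = root_unity n ^ l' / root_unity n ^ l"
  have "inj_on (\<lambda>k. root_unity n ^ k) {..<n}"
    using bij_betw_roots_unity[of n] assms(1)
    by (simp add: root_unity_power_eq_cis bij_betw_def)
  then have "root_unity n ^ l' \<noteq> root_unity n ^ l"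
    using False assms by (auto dest: inj_onD)
  then have "z \<noteq> 1"
    by (simp add: z_def)
  moreover have "z ^ n = 1"
  proof -
    have "(root_unity n ^ j) ^ n = 1" for j
      using assms(1) root_unity_power_order[of n]
      by (metis gr_implies_not0 mult.commute not_gr_zero power_mult power_one)
    then show ?thesis
      by (simp add: z_def power_divide)
  qed
  ultimately have "(\<Sum>q<n. z ^ q) = 0"
    by (simp add: geometric_sum)
  with False show ?thesis
    by (simp add: z_def)
qed simp

section \<open>Generalized circulants and the eigenvectors of the weighted permutation matrix\<close>

lemma weighted_perm_matrix_carrier: "weighted_perm_matrix m u s \<in> carrier_mat m m"
  unfolding weighted_perm_matrix_def
  by (rule mult_carrier_mat) (auto simp: diag_matrix_def perm_matrix_def)

lemma weighted_perm_matrix_mult_vec_index: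
  assumes i: "i < m" and v: "v \<in> carrier_vec m"
  shows "(weighted_perm_matrix m u s *\<^sub>v v) $ i = u $ i * v $ ((i + s) mod m)"
proof -
  have target: "Suc j = shift_perm m s (Suc i) \<longleftrightarrow> j = (i + s) mod m" if "j < m" for j
    using that by (auto simp: shift_perm_def mod_Suc)
  have perm: "(perm_matrix m (shift_perm m s) *\<^sub>v v) $ a = (\<Sum>j<m. (if Suc j = shift_perm m s (Suc a) then 1 else 0) * v $ j)"
    if "a < m" for a
    using that v by (simp add: perm_matrix_def scalar_prod_def atLeast0LessThan)
  have "weighted_perm_matrix m u s *\<^sub>v v = diag_matrix m u *\<^sub>v (perm_matrix m (shift_perm m s) *\<^sub>v v)"
    unfolding weighted_perm_matrix_def
    by (rule assoc_mult_mat_vec) (use v in \<open>auto simp: diag_matrix_def perm_matrix_def\<close>)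
  also have "\<dots> $ i = (\<Sum>a<m. (if i = a then u $ i else 0) * (perm_matrix m (shift_perm m s) *\<^sub>v v) $ a)"
    using i by (auto simp: diag_matrix_def scalar_prod_def atLeast0LessThan perm_matrix_def entry_def
        intro!: sum.cong)
  also have "\<dots> = (\<Sum>a<m. if a = i then u $ i * (perm_matrix m (shift_perm m s) *\<^sub>v v) $ i else 0)"
    by (rule sum.cong) auto
  also have "\<dots> = u $ i * (perm_matrix m (shift_perm m s) *\<^sub>v v) $ i"
    using i by simp
  also have "(perm_matrix m (shift_perm m s) *\<^sub>v v) $ i = (\<Sum>j<m. if j = (i + s) mod m then v $ ((i + s) mod m) else 0)"
    unfolding perm[OF i]
    by (rule sum.cong) (auto simp: target)
  also have "\<dots> = v $ ((i + s) mod m)"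
    using i by simp
  finally show ?thesis .
qed

lemma smult_mat_mult_vec:
  fixes A :: "'a :: comm_ring_1 mat"
  assumes "A \<in> carrier_mat n n" and "v \<in> carrier_vec n"
  shows "(a \<cdot>\<^sub>m A) *\<^sub>v v = a \<cdot>\<^sub>v (A *\<^sub>v v)"
  using assms by (intro eq_vecI) auto

lemma eigenvector_gen_circulant:
  assumes ev: "eigenvector (weighted_perm_matrix m u s) v \<mu>"
  shows "eigenvector (gen_circulant m u s k c) v (\<Sum>r\<le>k. c r * \<mu> ^ r)"
proof -
  let ?P = "weighted_perm_matrix m u s"
  interpret abelian_group "module_mat TYPE(complex) m m"
    by (rule abelian_group_mat)
  have P: "?P \<in> carrier_mat m m"
    by (rule weighted_perm_matrix_carrier)
  have v: "v \<in> carrier_vec m" and nonzero: "v \<noteq> 0\<^sub>v m"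
    using ev P by (auto simp: eigenvector_def)
  have term_carrier: "c r \<cdot>\<^sub>m (?P ^\<^sub>m r) \<in> carrier_mat m m" for r
    using P by simp
  have term_mult: "(c r \<cdot>\<^sub>m (?P ^\<^sub>m r)) *\<^sub>v v = (c r * \<mu> ^ r) \<cdot>\<^sub>v v" for r
    using eigenvector_pow[OF P ev, of r] P v
    by (simp add: smult_mat_mult_vec[of _ m] smult_smult_assoc)
  have "gen_circulant m u s k c \<in> carrier_mat m m
    \<and> gen_circulant m u s k c *\<^sub>v v = (\<Sum>r\<le>k. c r * \<mu> ^ r) \<cdot>\<^sub>v v"
  proof (induction k)
    case 0
    have "gen_circulant m u s 0 c = c 0 \<cdot>\<^sub>m (?P ^\<^sub>m 0)"
      using finsum_insert[of "{}" 0 "\<lambda>r. c r \<cdot>\<^sub>m (?P ^\<^sub>m r)"] term_carrier[of 0]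
      by (simp add: gen_circulant_def module_mat_simps)
    then show ?case
      using term_carrier[of 0] term_mult[of 0] by simp
  next
    case (Suc k)
    have "gen_circulant m u s (Suc k) c
        = c (Suc k) \<cdot>\<^sub>m (?P ^\<^sub>m (Suc k)) + gen_circulant m u s k c"
      using finsum_insert[of "{0..k}" "Suc k" "\<lambda>r. c r \<cdot>\<^sub>m (?P ^\<^sub>m r)"] term_carrier
      by (simp add: gen_circulant_def module_mat_simps atLeast0_atMost_Suc del: pow_mat.simps)
    then show ?case
      using Suc term_carrier[of "Suc k"] term_mult[of "Suc k"] v
      by (simp add: add_mult_distrib_mat_vec[of _ m m] add_smult_distrib_vec[symmetric]
          add.commute del: pow_mat.simps)
  qed
  with v nonzero show ?thesis
    by (auto simp: eigenvector_def)
qed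

section \<open>The vectors attached to a residue class\<close>

text \<open>
  As long as the last position of the class is not passed, the orbit of \<open>t\<close> does not wrap around, so
  the orbit products of length at most \<open>k\<^sub>0\<close> are products of entries of \<open>u\<close> at equally spaced positions.
\<close>

lemma shift_perm_funpow:
  assumes "1 \<le> s" and "t + l * s \<le> m"
  shows "(shift_perm m s ^^ l) t = t + l * s"
  using assms(2)
proof (induction l)
  case (Suc l)
  then have "(shift_perm m s ^^ Suc l) t = shift_perm m s (t + l * s)"
    by simp
  also have "\<dots> = t + Suc l * s"
    using Suc.prems assms(1) by (cases "t + Suc l * s = m") (auto simp: shift_perm_def add_ac)
  finally show ?case .
qed simp

lemma orbit_prod_eq:
  assumes "1 \<le> s" and "t \<in> {1..s}" and "j \<le> k\<^sub>0"
  shows "orbit_prod (k\<^sub>0 * s) u s j t = (\<Prod>q<j. u $ (q * s + (t - 1)))"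
  unfolding orbit_prod_def
proof (rule prod.cong)
  fix q assume "q \<in> {..<j}"
  then have "Suc q * s \<le> k\<^sub>0 * s"
    using assms(3) by (intro mult_right_mono) auto
  then have "t + q * s \<le> k\<^sub>0 * s"
    using assms(2) by simp
  then show "entry u ((shift_perm (k\<^sub>0 * s) s ^^ q) t) = u $ (q * s + (t - 1))"
    using assms by (simp add: shift_perm_funpow entry_def add.commute)
qed simp

lemma T_vec_carrier: "T_vec m u s k\<^sub>0 t lam l \<in> carrier_vec (k\<^sub>0 * s)"
  by (simp add: T_vec_def)

text \<open>
  Absorbing the factor \<open>\<omega> ^ (q l)\<close> into \<open>lam ^ q\<close> shows the geometric dependence on the eigenvalue
  \<open>lam \<omega>\<^sup>l\<close>; one factor \<open>\<omega>\<^sup>l\<close> is left over because the blocks are numbered from \<open>1\<close>.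
\<close>

lemma T_vec_index:
  assumes "i < k\<^sub>0 * s" and "t \<in> {1..s}"
  shows "T_vec m u s k\<^sub>0 t lam l $ i =
    (if i mod s = t - 1
     then root_unity k\<^sub>0 ^ l * (lam * root_unity k\<^sub>0 ^ l) ^ (i div s) / orbit_prod m u s (i div s) t
     else 0)"
proof -
  have "i mod s < s"
    using assms(2) by simp
  then show ?thesis
    using assms by (simp add: T_vec_def T_block_def Let_def power_add power_mult power_mult_distrib
        unit_vec_def mult_ac flip: power_mult)
qed

locale weighted_cycle_class =
  fixes m s k\<^sub>0 :: nat and u :: "complex vec" and t :: nat and lam :: complex
  assumes s_pos: "1 \<le> s" and k0_pos: "0 < k\<^sub>0" and m_eq: "m = k\<^sub>0 * s"
    and u_nonzero: "\<And>i. i < m \<Longrightarrow> u $ i \<noteq> 0"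
    and t_range: "t \<in> {1..s}"
    and lam_root: "lam ^ k\<^sub>0 = orbit_prod m u s k\<^sub>0 t"
begin

lemma position_less:
  assumes "q < k\<^sub>0"
  shows "q * s + (t - 1) < m"
proof -
  have "Suc q * s \<le> m"
    unfolding m_eq using assms by (intro mult_right_mono) auto
  then show ?thesis
    using t_range by auto
qed

lemma orbit_prod_nonzero: "j \<le> k\<^sub>0 \<Longrightarrow> orbit_prod m u s j t \<noteq> 0"
  using orbit_prod_eq[OF s_pos t_range, of j k\<^sub>0 u] u_nonzero position_less
  by (auto simp: m_eq)

lemma lam_nonzero: "lam \<noteq> 0"
  using lam_root orbit_prod_nonzero[of k\<^sub>0] k0_pos by (metis order_refl zero_power)

lemma orbit_prod_Suc:
  "q < k\<^sub>0 \<Longrightarrow> orbit_prod m u s (Suc q) t = orbit_prod m u s q t * u $ (q * s + (t - 1))"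
  using orbit_prod_eq[OF s_pos t_range, of _ k\<^sub>0 u] by (simp add: m_eq)

lemma T_vec_nonzero: "T_vec m u s k\<^sub>0 t lam l \<noteq> 0\<^sub>v m"
proof
  assume "T_vec m u s k\<^sub>0 t lam l = 0\<^sub>v m"
  moreover have "t - 1 < m"
    using position_less[of 0] k0_pos by simp
  ultimately have "T_vec m u s k\<^sub>0 t lam l $ (t - 1) = 0"
    by simp
  moreover have "(t - 1) div s = 0" "(t - 1) mod s = t - 1"
    using t_range by auto
  ultimately show False
    using \<open>t - 1 < m\<close> orbit_prod_nonzero[of 0] T_vec_index[of "t - 1" k\<^sub>0 s t m u lam l] t_range
    by (simp add: m_eq)
qed

text \<open>
  Passing to the next block multiplies the entry by \<open>\<mu> = lam \<omega>\<^sup>l\<close> and divides it by the weight, and the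
  matrix multiplies by that weight again, so \<open>\<mu>\<close> remains. After the last block the cycle returns to
  block \<open>1\<close>; there the rule continues to hold because \<open>\<mu> ^ k\<^sub>0 = lam ^ k\<^sub>0\<close> equals the full orbit product.
\<close>

lemma weighted_perm_eigenvector:
  "eigenvector (weighted_perm_matrix m u s) (T_vec m u s k\<^sub>0 t lam l) (lam * root_unity k\<^sub>0 ^ l)"
proof -
  let ?v = "T_vec m u s k\<^sub>0 t lam l" and ?\<mu> = "lam * root_unity k\<^sub>0 ^ l"
  have v: "?v \<in> carrier_vec m"
    using T_vec_carrier by (simp add: m_eq)
  have mu_power: "?\<mu> ^ k\<^sub>0 = orbit_prod m u s k\<^sub>0 t"
    using root_unity_power_order[OF k0_pos]
    by (simp add: power_mult_distrib lam_root mult.commute flip: power_mult)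
      (simp add: power_mult)
  have "u $ i * ?v $ ((i + s) mod m) = ?\<mu> * ?v $ i" if i: "i < m" for i
  proof -
    define q where "q = i div s"
    have q: "q < k\<^sub>0"
      using i by (simp add: q_def m_eq less_mult_imp_div_less)
    have next_less: "(i + s) mod m < k\<^sub>0 * s"
      using i unfolding m_eq by (intro mod_less_divisor) (use k0_pos s_pos in simp)
    have next_mod: "(i + s) mod m mod s = i mod s"
      by (simp add: m_eq mod_mod_cancel)
    have next_div: "(i + s) mod m div s = Suc q mod k\<^sub>0"
      using s_pos by (simp add: m_eq q_def mult.commute[of k\<^sub>0] mod_mult2_eq)
    show ?thesis
    proof (cases "i mod s = t - 1")
      case True
      then have "i = q * s + (t - 1)"
        unfolding q_def by (metis div_mult_mod_eq)
      then have u: "u $ i = orbit_prod m u s (Suc q) t / orbit_prod m u s q t"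
        using orbit_prod_Suc[OF q] orbit_prod_nonzero[of q] q
        by simp
      \<comment> \<open>For \<open>Suc q = k\<^sub>0\<close> both sides are \<open>1\<close>: the cycle closes.\<close>
      have step: "?\<mu> ^ (Suc q mod k\<^sub>0) / orbit_prod m u s (Suc q mod k\<^sub>0) t
          = ?\<mu> ^ Suc q / orbit_prod m u s (Suc q) t"
      proof (cases "Suc q = k\<^sub>0")
        case True
        then show ?thesis
          using mu_power orbit_prod_nonzero[of k\<^sub>0] by (simp add: orbit_prod_def del: power_Suc)
      next
        case False
        with q show ?thesis by simp
      qed
      have v_next: "?v $ ((i + s) mod m) = root_unity k\<^sub>0 ^ l * (?\<mu> ^ Suc q / orbit_prod m u s (Suc q) t)"
        unfolding step[symmetric] using T_vec_index[OF next_less t_range, of m u lam l] True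
        by (simp add: next_mod next_div)
      have v_i: "?v $ i = root_unity k\<^sub>0 ^ l * (?\<mu> ^ q / orbit_prod m u s q t)"
        using T_vec_index[OF i[unfolded m_eq] t_range, of m u lam l] True
        by (simp add: q_def)
      show ?thesis
        unfolding u v_next v_i using orbit_prod_nonzero[of "Suc q"] q by simp
    next
      case False
      then show ?thesis
        using T_vec_index[OF next_less t_range, of m u lam l]
          T_vec_index[OF i[unfolded m_eq] t_range, of m u lam l]
        by (simp add: next_mod)
    qed
  qed
  then have "weighted_perm_matrix m u s *\<^sub>v ?v = ?\<mu> \<cdot>\<^sub>v ?v"
    using v weighted_perm_matrix_carrier[of m u s]
    by (intro eq_vecI) (auto simp: weighted_perm_matrix_mult_vec_index simp del: index_mult_mat_vec)
  then show ?thesis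
    using v T_vec_nonzero weighted_perm_matrix_carrier[of m u s] by (auto simp: eigenvector_def)
qed

end

section \<open>The dual family\<close>

text \<open>
  In the scalar product with another vector of the same class, entrywise inverses make the orbit
  products and the powers of \<open>lam\<close> cancel, so that only a geometric sum in a quotient of powers of
  \<open>\<omega>\<close> is left. Because \<open>inverse 0 = 0\<close>, the dual vector has the same support as the original one.
\<close>

definition T_dual :: "nat \<Rightarrow> complex vec \<Rightarrow> nat \<Rightarrow> nat \<Rightarrow> nat \<Rightarrow> complex \<Rightarrow> nat \<Rightarrow> complex vec" where
  "T_dual m u s k\<^sub>0 t lam l = vec m (\<lambda>i. inverse (T_vec m u s k\<^sub>0 t lam l $ i))"

lemma T_vec_T_dual_other_class:
  assumes "m = k\<^sub>0 * s" and "t \<in> {1..s}" and "t' \<in> {1..s}" and "t \<noteq> t'"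
  shows "T_vec m u s k\<^sub>0 t' lam' l' \<bullet> T_dual m u s k\<^sub>0 t lam l = 0"
  unfolding scalar_prod_def T_dual_def
  by (rule sum.neutral) (use assms T_vec_index in auto)

lemma (in weighted_cycle_class) T_vec_biorthogonal:
  assumes l: "l < k\<^sub>0" and l': "l' < k\<^sub>0"
  shows "T_vec m u s k\<^sub>0 t lam l' \<bullet> T_dual m u s k\<^sub>0 t lam l = (if l = l' then of_nat k\<^sub>0 else 0)"
proof -
  let ?w = "\<lambda>l. root_unity k\<^sub>0 ^ l"
  let ?v = "\<lambda>l. T_vec m u s k\<^sub>0 t lam l"
  let ?h = "\<lambda>q. q * s + (t - 1)"
  have on_class: "?v l' $ ?h q * inverse (?v l $ ?h q) = ?w l' / ?w l * (?w l' / ?w l) ^ q"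
    if q: "q < k\<^sub>0" for q
  proof -
    have "t - 1 < s"
      using t_range by auto
    moreover define p where "p = ?h q"
    ultimately have p: "p div s = q" "p mod s = t - 1"
      by (simp_all del: add_diff_assoc)
    have "p < m"
      unfolding p_def by (rule position_less[OF q])
    then have v_p: "?v j $ p = ?w j * (lam * ?w j) ^ q / orbit_prod m u s q t" for j
      using T_vec_index[of p k\<^sub>0 s t m u lam j] t_range
      by (simp add: m_eq p)
    then show ?thesis
      using orbit_prod_nonzero[of q] q lam_nonzero
      unfolding p_def[symmetric] v_p by (simp add: field_simps)
  qed
  have off_class: "?v l' $ i * inverse (?v l $ i) = 0" if "i < m" and "i \<notin> ?h ` {..<k\<^sub>0}" for i
  proof -
    have "i mod s \<noteq> t - 1"
    proof
      assume "i mod s = t - 1"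
      then have "i = ?h (i div s)"
        by (metis div_mult_mod_eq)
      moreover have "i div s < k\<^sub>0"
        using that(1) by (simp add: m_eq less_mult_imp_div_less)
      ultimately show False
        using that(2) by blast
    qed
    then show ?thesis
      using T_vec_index[of i k\<^sub>0 s t m u lam l'] that(1) t_range by (simp add: m_eq)
  qed
  have inj: "inj_on ?h {..<k\<^sub>0}"
    using s_pos by (auto simp: inj_on_def)
  have "?v l' \<bullet> T_dual m u s k\<^sub>0 t lam l = (\<Sum>i<m. ?v l' $ i * inverse (?v l $ i))"
    by (simp add: scalar_prod_def T_dual_def atLeast0LessThan)
  also have "\<dots> = (\<Sum>i\<in>?h ` {..<k\<^sub>0}. ?v l' $ i * inverse (?v l $ i))"
    using position_less off_class by (intro sum.mono_neutral_right) auto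
  also have "\<dots> = (\<Sum>q<k\<^sub>0. ?w l' / ?w l * (?w l' / ?w l) ^ q)"
    unfolding sum.reindex[OF inj] o_def using on_class by (intro sum.cong) auto
  also have "\<dots> = ?w l' / ?w l * (\<Sum>q<k\<^sub>0. (?w l' / ?w l) ^ q)"
    by (simp only: sum_distrib_left)
  finally show ?thesis
    using sum_root_unity_quotient[OF l l'] by simp
qed

theorem proposition2p8:
  fixes m s k\<^sub>0 k :: nat
    and u :: "complex vec"
    and c :: "nat \<Rightarrow> complex"
    and lam :: "nat \<Rightarrow> complex"
  assumes "1 \<le> s" and "s \<le> m - 1" and "s dvd m" and "m = k\<^sub>0 * s"
    and "u \<in> carrier_vec m"
    and "\<forall>i\<in>{1..m}. entry u i \<noteq> 0"
    and "\<forall>t\<in>{1..s}. lam t ^ k\<^sub>0 = orbit_prod m u s k\<^sub>0 t"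
  shows "inj_on (\<lambda>(t, l). T_vec m u s k\<^sub>0 t (lam t) l) ({1..s} \<times> {0..<k\<^sub>0})
    \<and> vectorspace.basis class_ring (module_vec TYPE(complex) m)
        {T_vec m u s k\<^sub>0 t (lam t) l | t l. t \<in> {1..s} \<and> l \<in> {0..<k\<^sub>0}}
    \<and> (\<forall>t\<in>{1..s}. \<forall>l\<in>{0..<k\<^sub>0}.
        \<exists>\<mu>. eigenvector (gen_circulant m u s k c) (T_vec m u s k\<^sub>0 t (lam t) l) \<mu>)"
proof -
  have k0_pos: "0 < k\<^sub>0"
    using assms(1,2,4) by (cases k\<^sub>0) auto
  have u_nonzero: "u $ i \<noteq> 0" if "i < m" for i
    using assms(6)[rule_format, of "Suc i"] that by (simp add: entry_def)
  have cycle_class: "weighted_cycle_class m s k\<^sub>0 u t (lam t)" if "t \<in> {1..s}" for t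
    using assms k0_pos u_nonzero that by unfold_locales auto
  let ?I = "{1..s} \<times> {0..<k\<^sub>0}"
  let ?f = "\<lambda>(t, l). T_vec m u s k\<^sub>0 t (lam t) l"
  let ?g = "\<lambda>(t, l). T_dual m u s k\<^sub>0 t (lam t) l"
  have finite: "finite ?I" and card: "card ?I = m"
    using assms(4) by (simp_all add: mult.commute)
  have f: "?f i \<in> carrier_vec m" for i
    using T_vec_carrier assms(4) by (simp add: case_prod_beta)
  have g: "?g i \<in> carrier_vec m" for i
    by (simp add: T_dual_def case_prod_beta)
  have diag: "?f i \<bullet> ?g i \<noteq> 0" if "i \<in> ?I" for i
    using that k0_pos weighted_cycle_class.T_vec_biorthogonal[OF cycle_class] by auto
  have off_diag: "?f j \<bullet> ?g i = 0" if "i \<in> ?I" "j \<in> ?I" "i \<noteq> j" for i j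
  proof (cases "fst i = fst j")
    case True
    with that have "snd i \<noteq> snd j"
      by (auto simp: prod_eq_iff)
    with True that show ?thesis
      using weighted_cycle_class.T_vec_biorthogonal[OF cycle_class] by auto
  next
    case False
    then show ?thesis
      using that T_vec_T_dual_other_class[OF assms(4)] by auto
  qed
  note basis = basis_of_biorthogonal[of ?I m ?f ?g, OF finite card f g diag off_diag]
  have image: "{T_vec m u s k\<^sub>0 t (lam t) l | t l. t \<in> {1..s} \<and> l \<in> {0..<k\<^sub>0}} = ?f ` ?I"
    by (auto simp: image_iff) blast
  have "\<exists>\<mu>. eigenvector (gen_circulant m u s k c) (T_vec m u s k\<^sub>0 t (lam t) l) \<mu>"
    if "t \<in> {1..s}" for t l
    using eigenvector_gen_circulant
      [OF weighted_cycle_class.weighted_perm_eigenvector[OF cycle_class[OF that]]]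
    by blast
  with basis image show ?thesis
    by simp
qed

end
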